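(* Let $W_{\ge 0}=\bigoplus_{n\in\mathbb{Z}_{\ge 0}}\mathbb{K}x_n$ be the Witt algebra with bracket $[x_n,x_m]_0=(n-m)x_{n+m}$. For $k\in\mathbb{Z}_{\ge 0}$ let $[\cdot,\cdot]_k$ be the bilinear map on $W_{\ge 0}$ and $\alpha_k$ the linear map on $W_{\ge 0}$ given on generators, for $n,m\in\mathbb{Z}_{\ge 0}$, by $$[x_n,x_m]_k=\left(\sum_{j=k}^{n-1}\binom{j}{k}-\sum_{j=k}^{m-1}\binom{j}{k}\right)x_{n+m}\quad (k\ge 0),$$ $$\alpha_0(x_n)=2x_n,\qquad \alpha_k(x_n)=\binom{n}{k}x_n\quad (k>0).$$ Then the one-parameter families $$[\cdot,\cdot]_t=\sum_{k\in\mathbb{Z}_{\ge 0}}[\cdot,\cdot]_k t^k,\qquad \alpha_t=\sum_{k\in\mathbb{Z}_{\ge 0}}\alpha_k t^k$$ define a formal Hom-Lie deformation of the Witt algebra $W_{\ge 0}$, regarded as the Hom-Lie algebra $(W_{\ge 0},[\cdot,\cdot]_0,\alpha_0)$.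
   Context: $\mathbb{K}$ is an algebraically closed field of characteristic $0$. Sums over empty index ranges are $0$. (For $k=0$ the formula for $[x_n,x_m]_k$ gives $(n-m)x_{n+m}$.) A Hom-Lie algebra is a triple $(V,[\cdot,\cdot],\alpha)$ with $[\cdot,\cdot]:V\times V\to V$ bilinear and $\alpha:V\to V$ linear such that $[x,y]=-[y,x]$ and $[\alpha(x),[y,z]]+[\alpha(y),[z,x]]+[\alpha(z),[x,y]]=0$ for all $x,y,z\in V$. $V[[t]]$ denotes the formal power series in $t$ with coefficients in $V$; bilinear and linear maps on $V$ are extended $\mathbb{K}[[t]]$-(bi)linearly (coefficientwise) to $V[[t]]$. A formal Hom-Lie deformation of a Hom-Lie algebra $(V,[\cdot,\cdot]_0,\alpha_0)$ is given by $[\cdot,\cdot]_t=\sum_{i\ge 0}[\cdot,\cdot]_i t^i$ and $\alpha_t=\sum_{i\ge 0}\alpha_i t^i$, where each $[\cdot,\cdot]_i:V\times V\to V$ is $\mathbb{K}$-bilinear and each $\alpha_i:V\to V$ is $\mathbb{K}$-linear (extended to $V[[t]]$), the terms of index $0$ being the given ones, such that for all $x,y,z\in V$: $[x,y]_t=-[y,x]_t$ and $[\alpha_t(x),[y,z]_t]_t+[\alpha_t(y),[z,x]_t]_t+[\alpha_t(z),[x,y]_t]_t=0$. *)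

theory Defs
  imports
    "HOL-Library.Poly_Mapping"
    "HOL-Computational_Algebra.Formal_Power_Series"
    "HOL-Computational_Algebra.Polynomial"
begin

section \<open>Hom-Lie algebras\<close>

definition bilinear_map ::
  "('k::field \<Rightarrow> 'v::ab_group_add \<Rightarrow> 'v) \<Rightarrow> ('v \<Rightarrow> 'v \<Rightarrow> 'v) \<Rightarrow> bool" where
  "bilinear_map scale B \<longleftrightarrow>
     (\<forall>x. Vector_Spaces.linear scale scale (B x)) \<and>
     (\<forall>y. Vector_Spaces.linear scale scale (\<lambda>x. B x y))"

locale hom_lie_algebra = vector_space scale
  for scale :: "'k::field \<Rightarrow> 'v::ab_group_add \<Rightarrow> 'v" +
  fixes bracket :: "'v \<Rightarrow> 'v \<Rightarrow> 'v"
    and twist :: "'v \<Rightarrow> 'v"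
  assumes bilinear_bracket: "bilinear_map scale bracket"
    and linear_twist: "Vector_Spaces.linear scale scale twist"
    and bracket_antisym: "bracket x y = - bracket y x"
    and hom_jacobi:
      "bracket (twist x) (bracket y z) + bracket (twist y) (bracket z x)
         + bracket (twist z) (bracket x y) = 0"

section \<open>Formal deformations\<close>

text \<open>
  The space \<open>V[[t]]\<close> is the type \<^typ>\<open>'v fps\<close>, of which only the additive structure is used;
  \<^const>\<open>fps_const\<close> is the inclusion of \<open>V\<close>. The next two definitions are the
  \<open>K[[t]]\<close>-(bi)linear extensions of (bi)linear maps on \<open>V\<close>.
\<close>

definition fps_ext_linear :: "('v \<Rightarrow> 'v) \<Rightarrow> 'v fps \<Rightarrow> 'v fps" where
  "fps_ext_linear A f = Abs_fps (\<lambda>n. A (fps_nth f n))"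

definition fps_ext_bilinear ::
  "('v \<Rightarrow> 'v \<Rightarrow> 'v::comm_monoid_add) \<Rightarrow> 'v fps \<Rightarrow> 'v fps \<Rightarrow> 'v fps" where
  "fps_ext_bilinear B f g = Abs_fps (\<lambda>n. \<Sum>i\<le>n. B (fps_nth f i) (fps_nth g (n - i)))"

text \<open>
  The maps \<open>\<Sum>i\<ge>0. A\<^sub>i t\<^sup>i\<close> and \<open>\<Sum>i\<ge>0. B\<^sub>i t\<^sup>i\<close> on \<open>V[[t]]\<close>: multiplication by \<open>t\<^sup>i\<close> shifts
  coefficients by \<open>i\<close>, so the \<open>n\<close>-th coefficient only involves \<open>i \<le> n\<close>.
\<close>

definition linear_series ::
  "(nat \<Rightarrow> 'v \<Rightarrow> 'v::comm_monoid_add) \<Rightarrow> 'v fps \<Rightarrow> 'v fps" where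
  "linear_series A f = Abs_fps (\<lambda>n. \<Sum>i\<le>n. fps_nth (fps_ext_linear (A i) f) (n - i))"

definition bilinear_series ::
  "(nat \<Rightarrow> 'v \<Rightarrow> 'v \<Rightarrow> 'v::comm_monoid_add) \<Rightarrow> 'v fps \<Rightarrow> 'v fps \<Rightarrow> 'v fps" where
  "bilinear_series B f g =
     Abs_fps (\<lambda>n. \<Sum>i\<le>n. fps_nth (fps_ext_bilinear (B i) f g) (n - i))"

locale formal_hom_lie_deformation = hom_lie_algebra scale bracket0 twist0
  for scale :: "'k::field \<Rightarrow> 'v::ab_group_add \<Rightarrow> 'v"
    and bracket0 :: "'v \<Rightarrow> 'v \<Rightarrow> 'v"
    and twist0 :: "'v \<Rightarrow> 'v" +
  fixes brackets :: "nat \<Rightarrow> 'v \<Rightarrow> 'v \<Rightarrow> 'v"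
    and twists :: "nat \<Rightarrow> 'v \<Rightarrow> 'v"
  assumes bilinear_brackets: "bilinear_map scale (brackets i)"
    and linear_twists: "Vector_Spaces.linear scale scale (twists i)"
    and brackets_0: "brackets 0 = bracket0"
    and twists_0: "twists 0 = twist0"
    and deformed_antisym:
      "bilinear_series brackets (fps_const x) (fps_const y) =
         - bilinear_series brackets (fps_const y) (fps_const x)"
    and deformed_hom_jacobi:
      "bilinear_series brackets (linear_series twists (fps_const x))
           (bilinear_series brackets (fps_const y) (fps_const z))
       + bilinear_series brackets (linear_series twists (fps_const y))
           (bilinear_series brackets (fps_const z) (fps_const x))
       + bilinear_series brackets (linear_series twists (fps_const z))
           (bilinear_series brackets (fps_const x) (fps_const y)) = 0"

section \<open>The Witt algebra\<close>

text \<open>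
  The space \<open>\<Oplus>n\<ge>0. K x\<^sub>n\<close> is the type of finitely supported functions
  \<^typ>\<open>nat \<Rightarrow>\<^sub>0 'k\<close>. Its library multiplication (convolution) plays no role.
\<close>

type_synonym 'k witt = "nat \<Rightarrow>\<^sub>0 'k"

definition witt_scale :: "'k::field \<Rightarrow> 'k witt \<Rightarrow> 'k witt" where
  "witt_scale c f = Poly_Mapping.map ((*) c) f"

definition witt_gen :: "nat \<Rightarrow> 'k::field witt" where
  "witt_gen n = Poly_Mapping.single n 1"

text \<open>The (bi)linear maps with prescribed values on the generators.\<close>

definition witt_linear :: "(nat \<Rightarrow> 'k::field witt) \<Rightarrow> 'k witt \<Rightarrow> 'k witt" where
  "witt_linear \<phi> f = (\<Sum>n\<in>Poly_Mapping.keys f. witt_scale (Poly_Mapping.lookup f n) (\<phi> n))"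

definition witt_bilinear ::
  "(nat \<Rightarrow> nat \<Rightarrow> 'k::field witt) \<Rightarrow> 'k witt \<Rightarrow> 'k witt \<Rightarrow> 'k witt" where
  "witt_bilinear \<phi> f g =
     (\<Sum>n\<in>Poly_Mapping.keys f. \<Sum>m\<in>Poly_Mapping.keys g.
        witt_scale (Poly_Mapping.lookup f n * Poly_Mapping.lookup g m) (\<phi> n m))"

definition witt_bracket :: "'k::field witt \<Rightarrow> 'k witt \<Rightarrow> 'k witt" where
  "witt_bracket =
     witt_bilinear (\<lambda>n m. witt_scale (of_nat n - of_nat m) (witt_gen (n + m)))"

definition witt_twist :: "'k::field witt \<Rightarrow> 'k witt" where
  "witt_twist = witt_linear (\<lambda>n. witt_scale 2 (witt_gen n))"

text \<open>
  The sum over \<open>k \<le> j \<le> n - 1\<close> is written over \<open>{k..<n}\<close>, which is empty for \<open>n = 0\<close>; with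
  truncated subtraction \<open>{k..n - 1}\<close> would not be when \<open>k = 0\<close>.
\<close>

definition witt_bracket_term :: "nat \<Rightarrow> 'k::field witt \<Rightarrow> 'k witt \<Rightarrow> 'k witt" where
  "witt_bracket_term k =
     witt_bilinear (\<lambda>n m.
       witt_scale ((\<Sum>j\<in>{k..<n}. of_nat (j choose k)) - (\<Sum>j\<in>{k..<m}. of_nat (j choose k)))
         (witt_gen (n + m)))"

definition witt_twist_term :: "nat \<Rightarrow> 'k::field witt \<Rightarrow> 'k witt" where
  "witt_twist_term k =
     (if k = 0 then witt_twist
      else witt_linear (\<lambda>n. witt_scale (of_nat (n choose k)) (witt_gen n)))"

lemma lookup_witt_scale [simp]:
  "Poly_Mapping.lookup (witt_scale c f) n = c * Poly_Mapping.lookup f n"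
  unfolding witt_scale_def by transfer (simp add: when_def)

lemma vector_space_witt_scale: "vector_space witt_scale"
  by unfold_locales (auto intro!: poly_mapping_eqI simp: lookup_add algebra_simps)

lemma witt_linear_gen: "witt_linear \<phi> (witt_gen n) = \<phi> n"
proof -
  interpret vector_space witt_scale by (rule vector_space_witt_scale)
  show ?thesis by (simp add: witt_linear_def witt_gen_def)
qed

lemma witt_bilinear_gen: "witt_bilinear \<phi> (witt_gen n) (witt_gen m) = \<phi> n m"
proof -
  interpret vector_space witt_scale by (rule vector_space_witt_scale)
  show ?thesis by (simp add: witt_bilinear_def witt_gen_def)
qed

end

theory Submission
  imports Defs
begin

text \<open>
  Put \<open>q = 1 + t\<close> and \<open>{n} = 1 + q + \<dots> + q\<^sup>n\<^sup>-\<^sup>1 = (q\<^sup>n - 1) / t\<close>. Since \<open>q\<^sup>j\<close> is the generating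
  function of the binomial coefficients \<open>j choose k\<close>, the two families sum up to a
  \<open>q\<close>-deformation of the Witt algebra:
  \<open>[x\<^sub>n, x\<^sub>m]\<^sub>t = ({n} - {m}) x\<^sub>n\<^sub>+\<^sub>m\<close> and \<open>\<alpha>\<^sub>t(x\<^sub>n) = (1 + q\<^sup>n) x\<^sub>n\<close>; the exceptional value
  \<open>\<alpha>\<^sub>0(x\<^sub>n) = 2 x\<^sub>n\<close> supplies the summand \<open>1\<close>.

  The coefficient of \<open>t\<^sup>N\<close> in the deformed Hom-Jacobi expression is trilinear in \<open>x, y, z\<close>
  over the ground field, so it suffices to test it on generators
  (\<open>trilinear_map_eq_zero_if_zero_on_gens\<close>). There the Hom-Jacobi identity is an identity of
  scalar power series (\<open>jacobi_coeff\<close>). Multiplied by \<open>t\<^sup>2\<close>, which is harmless in a domain, and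
  with \<open>a, b, c\<close> for the powers of \<open>q\<close> attached to the three generators, it says that the
  cyclic sum of \<open>(1 + a) (b - c) (a - b c)\<close> vanishes: a polynomial identity.

  The given Witt algebra needs no separate treatment, because its axioms are the coefficients of
  \<open>t\<^sup>0\<close> of the deformed ones.
\<close>

section \<open>Linear maps on the Witt space\<close>

interpretation witt: vector_space "witt_scale :: 'k::field \<Rightarrow> 'k witt \<Rightarrow> 'k witt"
  by (rule vector_space_witt_scale)

interpretation witt_pair: vector_space_pair
  "witt_scale :: 'k::field \<Rightarrow> 'k witt \<Rightarrow> 'k witt" "witt_scale :: 'k \<Rightarrow> 'k witt \<Rightarrow> 'k witt"
  by unfold_locales

abbreviation witt_lin :: "('k::field witt \<Rightarrow> 'k witt) \<Rightarrow> bool" where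
  "witt_lin \<equiv> Vector_Spaces.linear witt_scale witt_scale"

lemma witt_expansion:
  "x = (\<Sum>n\<in>Poly_Mapping.keys x. witt_scale (Poly_Mapping.lookup x n) (witt_gen n))"
  by (rule poly_mapping_eqI)
     (auto simp: lookup_sum witt_gen_def lookup_single when_def in_keys_iff if_distrib
       cong: if_cong)

lemma witt_lin_eq_zero_if_zero_on_gens:
  assumes "witt_lin f" "\<And>n. f (witt_gen n) = 0"
  shows "f x = 0"
proof -
  have "f x = (\<Sum>n\<in>Poly_Mapping.keys x. witt_scale (Poly_Mapping.lookup x n) (f (witt_gen n)))"
    by (subst witt_expansion)
       (simp only: witt_pair.linear_sum[OF assms(1)] witt_pair.linear_scale[OF assms(1)])
  then show ?thesis using assms(2) by simp
qed

text \<open>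
  Additivity has to compare sums over the supports of \<open>f\<close>, \<open>g\<close> and \<open>f + g\<close>; this makes it possible
  to sum over one common index set.
\<close>

lemma witt_linear_eq_sum_superset:
  assumes "finite S" "Poly_Mapping.keys f \<subseteq> S"
  shows "witt_linear \<phi> f = (\<Sum>n\<in>S. witt_scale (Poly_Mapping.lookup f n) (\<phi> n))"
  unfolding witt_linear_def
  by (rule sum.mono_neutral_left) (use assms in \<open>auto simp: in_keys_iff\<close>)

lemma witt_lin_witt_linear: "witt_lin (witt_linear (\<phi> :: nat \<Rightarrow> 'k::field witt))"
unfolding Vector_Spaces.linear_iff
proof (intro conjI allI vector_space_witt_scale)
  fix f g :: "'k witt"
  let ?S = "Poly_Mapping.keys f \<union> Poly_Mapping.keys g"
  have "Poly_Mapping.keys (f + g) \<subseteq> ?S" by (rule keys_add)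
  then show "witt_linear \<phi> (f + g) = witt_linear \<phi> f + witt_linear \<phi> g"
    by (simp add: witt_linear_eq_sum_superset[of ?S] lookup_add
        witt.scale_left_distrib sum.distrib)
next
  fix c :: 'k and f :: "'k witt"
  have "Poly_Mapping.keys (witt_scale c f) \<subseteq> Poly_Mapping.keys f"
    by (auto simp: in_keys_iff)
  then show "witt_linear \<phi> (witt_scale c f) = witt_scale c (witt_linear \<phi> f)"
    by (simp add: witt_linear_eq_sum_superset[of "Poly_Mapping.keys f"] witt.scale_sum_right)
qed

text \<open>
  Iterating \<^const>\<open>witt_linear\<close> reduces bilinearity to linearity in each slot.
\<close>

lemma witt_bilinear_eq_witt_linear:
  "witt_bilinear \<phi> x y = witt_linear (\<lambda>n. witt_linear (\<phi> n) y) x"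
  by (simp add: witt_bilinear_def witt_linear_def witt.scale_sum_right)

lemma bilinear_map_witt_bilinear: "bilinear_map witt_scale (witt_bilinear \<phi>)"
  unfolding bilinear_map_def
proof (intro conjI allI)
  fix x
  show "witt_lin (witt_bilinear \<phi> x)"
    unfolding witt_bilinear_eq_witt_linear witt_linear_def[of _ x]
    by (intro witt_pair.linear_compose_sum ballI witt_pair.linear_compose_scale_right
        witt_lin_witt_linear)
next
  fix y
  show "witt_lin (\<lambda>x. witt_bilinear \<phi> x y)"
    unfolding witt_bilinear_eq_witt_linear by (rule witt_lin_witt_linear)
qed

lemma bilinear_map_scale_scale:
  assumes "bilinear_map witt_scale B"
  shows "B (witt_scale a x) (witt_scale b y) = witt_scale (a * b) (B x y)"
proof -
  have "witt_lin (\<lambda>x. B x (witt_scale b y))" and "witt_lin (B x)"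
    using assms by (auto simp: bilinear_map_def)
  then show ?thesis
    by (simp add: witt_pair.linear_scale[of "\<lambda>x. B x (witt_scale b y)"]
        witt_pair.linear_scale[of "B x"])
qed

lemma witt_bilinear_antisym:
  assumes "\<And>n m. \<phi> n m = - \<phi> m n"
  shows "witt_bilinear \<phi> x y = - witt_bilinear \<phi> y x"
proof -
  have eq: "witt_scale (a * b) (\<phi> n m) = - witt_scale (b * a) (\<phi> m n)" for a b n m
    by (subst assms) (simp only: witt.scale_minus_right mult.commute)
  have "witt_bilinear \<phi> x y = (\<Sum>m\<in>Poly_Mapping.keys y. \<Sum>n\<in>Poly_Mapping.keys x.
      witt_scale (Poly_Mapping.lookup x n * Poly_Mapping.lookup y m) (\<phi> n m))"
    unfolding witt_bilinear_def by (rule sum.swap)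
  also have "\<dots> = (\<Sum>m\<in>Poly_Mapping.keys y. \<Sum>n\<in>Poly_Mapping.keys x.
      - witt_scale (Poly_Mapping.lookup y m * Poly_Mapping.lookup x n) (\<phi> m n))"
    by (intro sum.cong refl eq)
  finally show ?thesis
    by (simp only: witt_bilinear_def sum_negf)
qed

definition trilinear_map :: "('k::field witt \<Rightarrow> 'k witt \<Rightarrow> 'k witt \<Rightarrow> 'k witt) \<Rightarrow> bool" where
  "trilinear_map T \<longleftrightarrow>
     (\<forall>y z. witt_lin (\<lambda>x. T x y z)) \<and> (\<forall>x z. witt_lin (\<lambda>y. T x y z)) \<and> (\<forall>x y. witt_lin (T x y))"

lemma trilinear_map_eq_zero_if_zero_on_gens:
  assumes T: "trilinear_map T"
    and gen: "\<And>n m l. T (witt_gen n) (witt_gen m) (witt_gen l) = 0"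
  shows "T x y z = 0"
proof -
  have lin: "witt_lin (\<lambda>x. T x y z)" "witt_lin (\<lambda>y. T x y z)" "witt_lin (T x y)" for x y z
    using T by (simp_all add: trilinear_map_def)
  have 1: "T (witt_gen n) (witt_gen m) z = 0" for n m z
    by (rule witt_lin_eq_zero_if_zero_on_gens[OF lin(3) gen])
  have 2: "T (witt_gen n) y z = 0" for n y z
    by (rule witt_lin_eq_zero_if_zero_on_gens[OF lin(2) 1])
  show ?thesis
    by (rule witt_lin_eq_zero_if_zero_on_gens[OF lin(1) 2])
qed

lemma trilinear_map_cyclic_sum:
  assumes "trilinear_map T"
  shows "trilinear_map (\<lambda>x y z. T x y z + T y z x + T z x y)"
  using assms unfolding trilinear_map_def by (auto intro!: witt_pair.linear_compose_add)

lemma trilinear_map_sum: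
  assumes "\<And>i. i \<in> I \<Longrightarrow> trilinear_map (T i)"
  shows "trilinear_map (\<lambda>x y z. \<Sum>i\<in>I. T i x y z)"
  using assms unfolding trilinear_map_def by (auto intro!: witt_pair.linear_compose_sum)

lemma trilinear_map_nested_bracket:
  assumes B: "bilinear_map witt_scale B" and B': "bilinear_map witt_scale B'" and A: "witt_lin A"
  shows "trilinear_map (\<lambda>x y z. B (A x) (B' y z))"
  unfolding trilinear_map_def
proof (intro conjI allI)
  fix y z show "witt_lin (\<lambda>x. B (A x) (B' y z))"
    using Vector_Spaces.linear_compose[OF A, of witt_scale "\<lambda>x. B x (B' y z)"] B
    by (simp add: bilinear_map_def o_def)
next
  fix x z show "witt_lin (\<lambda>y. B (A x) (B' y z))"
    using Vector_Spaces.linear_compose[of witt_scale witt_scale "\<lambda>y. B' y z" witt_scale "B (A x)"] B B'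
    by (simp add: bilinear_map_def o_def)
next
  fix x y show "witt_lin (\<lambda>z. B (A x) (B' y z))"
    using Vector_Spaces.linear_compose[of witt_scale witt_scale "B' y" witt_scale "B (A x)"] B B'
    by (simp add: bilinear_map_def o_def)
qed

section \<open>Coefficients of the series\<close>

lemma bilinear_map_zero:
  assumes "bilinear_map witt_scale B"
  shows "B 0 y = 0" "B x 0 = 0"
  using assms witt_pair.linear_0[of "B x"] witt_pair.linear_0[of "\<lambda>x. B x y"]
  by (auto simp: bilinear_map_def)

lemma linear_series_const_nth:
  assumes "\<And>i. witt_lin (A i)"
  shows "fps_nth (linear_series A (fps_const x)) n = A n x"
proof -
  have "fps_nth (linear_series A (fps_const x)) n = (\<Sum>i\<le>n. if i = n then A n x else 0)"
    unfolding linear_series_def fps_ext_linear_def fps_nth_Abs_fps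
    using witt_pair.linear_0[OF assms] by (intro sum.cong) auto
  then show ?thesis by simp
qed

lemma bilinear_series_nth:
  "fps_nth (bilinear_series B f g) N =
     (\<Sum>i\<le>N. \<Sum>j\<le>N - i. B i (fps_nth f j) (fps_nth g (N - i - j)))"
  by (simp add: bilinear_series_def fps_ext_bilinear_def)

lemma bilinear_series_const_nth:
  assumes "\<And>i. bilinear_map witt_scale (B i)"
  shows "fps_nth (bilinear_series B (fps_const x) (fps_const y)) n = B n x y"
proof -
  have "(\<Sum>j\<le>n - i. B i (fps_nth (fps_const x) j) (fps_nth (fps_const y) (n - i - j)))
      = (if i = n then B n x y else 0)" if "i \<le> n" for i
  proof -
    have "(\<Sum>j\<le>n - i. B i (fps_nth (fps_const x) j) (fps_nth (fps_const y) (n - i - j)))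
        = (\<Sum>j\<le>n - i. if j = 0 then B i x (fps_nth (fps_const y) (n - i)) else 0)"
      using bilinear_map_zero[OF assms] by (intro sum.cong) auto
    then show ?thesis using that bilinear_map_zero[OF assms] by auto
  qed
  then show ?thesis by (simp add: bilinear_series_nth)
qed

section \<open>The structure constants as power series\<close>

definition q :: "'k::field fps" where "q = 1 + fps_X"

definition q_number :: "nat \<Rightarrow> 'k::field fps" where
  "q_number n = (\<Sum>j<n. q ^ j)"

text \<open>
  The reason why binomial coefficients appear in the deformation: this is the binomial theorem
  for \<open>(1 + t)\<^sup>n\<close>.
\<close>

lemma q_power_nth: "fps_nth (q ^ n :: 'k::field fps) k = of_nat (n choose k)"
proof -
  have "(q ^ n :: 'k fps) = (\<Sum>i\<le>n. of_nat (n choose i) * fps_X ^ i)"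
    unfolding q_def by (subst add.commute, subst binomial_ring) simp
  then show ?thesis
    by (auto simp: fps_sum_nth fps_of_nat[symmetric] fps_X_power_iff binomial_eq_0
        if_distrib cong: if_cong)
qed

text \<open>
  The sum may start at \<open>k\<close> because \<open>j choose k\<close> vanishes for \<open>j < k\<close>.
\<close>

lemma q_number_nth:
  "fps_nth (q_number n :: 'k::field fps) k = (\<Sum>j\<in>{k..<n}. of_nat (j choose k))"
  unfolding q_number_def fps_sum_nth q_power_nth
  by (rule sum.mono_neutral_right) (auto simp: binomial_eq_0)

lemma fps_X_mult_q_number: "fps_X * q_number n = (q ^ n - 1 :: 'k::field fps)"
  using power_diff_1_eq[of "q :: 'k fps" n] by (simp add: q_number_def q_def)

definition bracket_coeff :: "nat \<Rightarrow> nat \<Rightarrow> 'k::field fps" where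
  "bracket_coeff n m = q_number n - q_number m"

definition twist_coeff :: "nat \<Rightarrow> 'k::field fps" where
  "twist_coeff n = 1 + q ^ n"

lemma fps_X_mult_bracket_coeff: "fps_X * bracket_coeff n m = (q ^ n - q ^ m :: 'k::field fps)"
  by (simp add: bracket_coeff_def right_diff_distrib fps_X_mult_q_number)

text \<open>
  Multiplying by \<open>t\<close> replaces each bracket coefficient by a difference of powers of \<open>q\<close>. Two
  brackets are nested, so \<open>t\<^sup>2\<close> clears both and leaves an identity in the ring generated by
  \<open>q\<^sup>n\<close>, \<open>q\<^sup>m\<close>, \<open>q\<^sup>l\<close>; the factor \<open>t\<^sup>2\<close> is cancelled at the end.
\<close>

lemma jacobi_coeff:
  "bracket_coeff n (m + l) * twist_coeff n * bracket_coeff m l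
   + bracket_coeff m (l + n) * twist_coeff m * bracket_coeff l n
   + bracket_coeff l (n + m) * twist_coeff l * bracket_coeff n m = (0 :: 'k::field fps)"
  (is "?J = 0")
proof -
  have "fps_X ^ 2 * ?J =
      (fps_X * bracket_coeff n (m + l)) * twist_coeff n * (fps_X * bracket_coeff m l)
    + (fps_X * bracket_coeff m (l + n)) * twist_coeff m * (fps_X * bracket_coeff l n)
    + (fps_X * bracket_coeff l (n + m)) * twist_coeff l * (fps_X * bracket_coeff n m)"
    by (simp add: power2_eq_square algebra_simps)
  also have "\<dots> = 0"
    unfolding fps_X_mult_bracket_coeff twist_coeff_def power_add by algebra
  finally show ?thesis by simp
qed

section \<open>The deformation\<close>

lemma witt_bracket_term_gen:
  "witt_bracket_term k (witt_gen n) (witt_gen m) =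
     witt_scale (fps_nth (bracket_coeff n m) k) (witt_gen (n + m))"
  by (simp add: witt_bracket_term_def witt_bilinear_gen bracket_coeff_def q_number_nth)

lemma witt_twist_term_gen:
  "witt_twist_term k (witt_gen n) = witt_scale (fps_nth (twist_coeff n) k) (witt_gen n)"
  by (simp add: witt_twist_term_def witt_twist_def witt_linear_gen twist_coeff_def q_power_nth)

lemma witt_bracket_term_0: "witt_bracket_term 0 = witt_bracket"
  by (simp add: witt_bracket_term_def witt_bracket_def)

lemma bilinear_map_witt_bracket_term: "bilinear_map witt_scale (witt_bracket_term k)"
  unfolding witt_bracket_term_def by (rule bilinear_map_witt_bilinear)

lemma witt_lin_witt_twist_term: "witt_lin (witt_twist_term k)"
  by (simp add: witt_twist_term_def witt_twist_def witt_lin_witt_linear)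

lemma witt_bracket_term_antisym: "witt_bracket_term k x y = - witt_bracket_term k y x"
  unfolding witt_bracket_term_def
proof (rule witt_bilinear_antisym)
  fix n m :: nat
  let ?c = "\<lambda>n. \<Sum>j\<in>{k..<n}. of_nat (j choose k) :: 'a"
  show "witt_scale (?c n - ?c m) (witt_gen (n + m)) = - witt_scale (?c m - ?c n) (witt_gen (m + n))"
    by (simp add: add.commute flip: witt.scale_minus_left)
qed

text \<open>
  The coefficient of \<open>t\<^sup>N\<close> in \<open>[\<alpha>\<^sub>t(x), [y, z]\<^sub>t]\<^sub>t\<close> (\<open>nested_series_nth\<close>).
\<close>

definition nested_coeff :: "nat \<Rightarrow> 'k::field witt \<Rightarrow> 'k witt \<Rightarrow> 'k witt \<Rightarrow> 'k witt" where
  "nested_coeff N x y z =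
     (\<Sum>i\<le>N. \<Sum>j\<le>N - i.
        witt_bracket_term i (witt_twist_term j x) (witt_bracket_term (N - i - j) y z))"

lemma nested_series_nth:
  "fps_nth (bilinear_series witt_bracket_term (linear_series witt_twist_term (fps_const x))
      (bilinear_series witt_bracket_term (fps_const y) (fps_const z))) N = nested_coeff N x y z"
  by (simp add: bilinear_series_nth[of _ "linear_series _ _"]
      linear_series_const_nth[OF witt_lin_witt_twist_term]
      bilinear_series_const_nth[OF bilinear_map_witt_bracket_term] nested_coeff_def)

text \<open>
  On generators every map acts by a scalar, so the convolution of maps in \<^const>\<open>nested_coeff\<close>
  becomes a convolution of scalars, that is, a product of power series.
\<close>

lemma nested_coeff_gen:
  "nested_coeff N (witt_gen n) (witt_gen m) (witt_gen l :: 'k::field witt) =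
     witt_scale (fps_nth (bracket_coeff n (m + l) * twist_coeff n * bracket_coeff m l) N)
       (witt_gen (n + m + l))"
proof -
  have "witt_bracket_term i (witt_twist_term j (witt_gen n))
          (witt_bracket_term k (witt_gen m) (witt_gen l :: 'k witt)) =
      witt_scale (fps_nth (bracket_coeff n (m + l)) i *
        (fps_nth (twist_coeff n) j * fps_nth (bracket_coeff m l) k)) (witt_gen (n + m + l))"
    for i j k
    by (simp add: witt_twist_term_gen witt_bracket_term_gen ac_simps
        bilinear_map_scale_scale[OF bilinear_map_witt_bracket_term])
  then show ?thesis
    by (simp add: nested_coeff_def mult.assoc fps_mult_nth atLeast0AtMost sum_distrib_left
        flip: witt.scale_sum_left)
qed

text \<open>
  By trilinearity only generators matter. For these, all three summands are multiples of the
  same generator, and the sum of their coefficients is the one in \<open>jacobi_coeff\<close>.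
\<close>

lemma nested_coeff_cyclic_sum:
  "nested_coeff N x y z + nested_coeff N y z x + nested_coeff N z x y = 0"
proof (rule trilinear_map_eq_zero_if_zero_on_gens
    [where T = "\<lambda>x y z. nested_coeff N x y z + nested_coeff N y z x + nested_coeff N z x y"])
  have "trilinear_map (nested_coeff N)"
    unfolding nested_coeff_def
    by (intro trilinear_map_sum trilinear_map_nested_bracket bilinear_map_witt_bracket_term
        witt_lin_witt_twist_term)
  then show "trilinear_map
      (\<lambda>x y z. nested_coeff N x y z + nested_coeff N y z x + nested_coeff N z x y)"
    by (rule trilinear_map_cyclic_sum)
next
  fix n m l :: nat
  have "m + l + n = n + m + l" "l + n + m = n + m + l" by simp_all
  then show "nested_coeff N (witt_gen n) (witt_gen m) (witt_gen l)
      + nested_coeff N (witt_gen m) (witt_gen l) (witt_gen n)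
      + nested_coeff N (witt_gen l) (witt_gen n) (witt_gen m) = 0"
    unfolding nested_coeff_gen
    by (simp only: jacobi_coeff fps_zero_nth witt.scale_zero_left
        flip: witt.scale_left_distrib fps_add_nth)
qed

theorem proposition6p4:
  shows "formal_hom_lie_deformation
           (witt_scale :: 'k::{alg_closed_field, field_char_0} \<Rightarrow> 'k witt \<Rightarrow> 'k witt)
           witt_bracket witt_twist witt_bracket_term witt_twist_term"
proof (intro formal_hom_lie_deformation.intro hom_lie_algebra.intro
    hom_lie_algebra_axioms.intro formal_hom_lie_deformation_axioms.intro vector_space_witt_scale)
  have twist_0: "witt_twist_term 0 = witt_twist"
    by (simp add: witt_twist_term_def)
  note order_0 = witt_bracket_term_0 twist_0
  fix x y z :: "'k witt" and i :: nat
  show "bilinear_map witt_scale (witt_bracket :: 'k witt \<Rightarrow> _)"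
    using bilinear_map_witt_bracket_term[of 0] by (simp add: order_0)
  show "witt_lin (witt_twist :: 'k witt \<Rightarrow> _)"
    using witt_lin_witt_twist_term[of 0] by (simp add: order_0)
  show "witt_bracket x y = - witt_bracket y x"
    using witt_bracket_term_antisym[of 0 x y] by (simp add: order_0)
  show "witt_bracket (witt_twist x) (witt_bracket y z)
      + witt_bracket (witt_twist y) (witt_bracket z x)
      + witt_bracket (witt_twist z) (witt_bracket x y) = 0"
    using nested_coeff_cyclic_sum[of 0 x y z] by (simp add: nested_coeff_def order_0)
  show "bilinear_map witt_scale (witt_bracket_term i :: 'k witt \<Rightarrow> _)"
    by (rule bilinear_map_witt_bracket_term)
  show "witt_lin (witt_twist_term i :: 'k witt \<Rightarrow> _)"
    by (rule witt_lin_witt_twist_term)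
  show "(witt_bracket_term 0 :: 'k witt \<Rightarrow> _) = witt_bracket"
       "(witt_twist_term 0 :: 'k witt \<Rightarrow> _) = witt_twist"
    by (simp_all add: order_0)
  show "bilinear_series witt_bracket_term (fps_const x) (fps_const y) =
      - bilinear_series witt_bracket_term (fps_const y) (fps_const x)"
    by (rule fps_ext) (simp add: bilinear_series_const_nth[OF bilinear_map_witt_bracket_term]
        witt_bracket_term_antisym[of _ x y])
  show "bilinear_series witt_bracket_term (linear_series witt_twist_term (fps_const x))
         (bilinear_series witt_bracket_term (fps_const y) (fps_const z))
     + bilinear_series witt_bracket_term (linear_series witt_twist_term (fps_const y))
         (bilinear_series witt_bracket_term (fps_const z) (fps_const x))
     + bilinear_series witt_bracket_term (linear_series witt_twist_term (fps_const z))
         (bilinear_series witt_bracket_term (fps_const x) (fps_const y)) = 0"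
    by (rule fps_ext) (simp add: nested_series_nth nested_coeff_cyclic_sum)
qed

end
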